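(* Let $\mathbb{X}$ and $\mathbb{Y}$ be two real normed linear spaces and let $T \in \mathbb{B}(\mathbb{X},\mathbb{Y})$ be nonzero. Then for any $A \in \mathbb{B}(\mathbb{X},\mathbb{Y})$, $T \perp_B A$ if and only if at least one of the following conditions (a), (b) holds: (a) There exists a sequence $\{x_n\}$ in $S_{\mathbb{X}}$ such that $\|Tx_n\| \to \|T\|$ and $\|Ax_n\| \to 0$ as $n \to \infty$. (b) There exist two sequences $\{x_n\}$, $\{y_n\}$ in $S_{\mathbb{X}}$ and two sequences of positive real numbers $\{\epsilon_n\}$, $\{\delta_n\}$ in $[0,1)$ such that: (i) $\epsilon_n \to 0$ and $\delta_n \to 0$ as $n \to \infty$; (ii) $\|Tx_n\| \to \|T\|$ and $\|Ty_n\| \to \|T\|$ as $n \to \infty$; (iii) $Ax_n \in (Tx_n)^{+(\epsilon_n)}$ and $Ay_n \in (Ty_n)^{-(\delta_n)}$ for all $n \in \mathbb{N}$.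
   Context: All normed linear spaces are real. $\mathbb{B}(\mathbb{X},\mathbb{Y})$ is the space of bounded linear operators from $\mathbb{X}$ to $\mathbb{Y}$ with the operator norm. $S_{\mathbb{X}} = \{x \in \mathbb{X} : \|x\| = 1\}$. Birkhoff-James orthogonality: $T \perp_B A$ means $\|T\| \le \|T + \lambda A\|$ for all $\lambda \in \mathbb{R}$. For $u, v$ in a normed linear space and $\epsilon \in [0,1)$, $v \in u^{+(\epsilon)}$ means $\|u + \lambda v\| \ge \sqrt{1-\epsilon^2}\,\|u\|$ for all $\lambda \ge 0$, and $v \in u^{-(\epsilon)}$ means $\|u + \lambda v\| \ge \sqrt{1-\epsilon^2}\,\|u\|$ for all $\lambda \le 0$. *)

theory Defs
  imports "HOL-Analysis.Analysis"
begin

definition birkhoff_james :: "'a::real_normed_vector \<Rightarrow> 'a \<Rightarrow> bool"  (infix \<open>\<bottom>\<^sub>B\<close> 50)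
  where "u \<bottom>\<^sub>B v \<longleftrightarrow> (\<forall>t::real. norm u \<le> norm (u + t *\<^sub>R v))"

text \<open>The sets \<open>u\<^sup>+\<^sup>(\<^sup>\<epsilon>\<^sup>)\<close> and \<open>u\<^sup>-\<^sup>(\<^sup>\<epsilon>\<^sup>)\<close>, intended for \<open>\<epsilon> \<in> {0..<1}\<close>.\<close>

definition approx_plus :: "real \<Rightarrow> 'a::real_normed_vector \<Rightarrow> 'a set"
  where "approx_plus \<epsilon> u = {v. \<forall>t\<ge>0. norm (u + t *\<^sub>R v) \<ge> sqrt (1 - \<epsilon>\<^sup>2) * norm u}"

definition approx_minus :: "real \<Rightarrow> 'a::real_normed_vector \<Rightarrow> 'a set"
  where "approx_minus \<epsilon> u = {v. \<forall>t\<le>0. norm (u + t *\<^sub>R v) \<ge> sqrt (1 - \<epsilon>\<^sup>2) * norm u}"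

end

theory Submission
  imports Defs
begin

text \<open>For the forward direction, take a unit vector \<open>x\<close> at which \<open>T + sA\<close> almost attains its
  norm, up to an error \<open>s\<^sup>2\<close>. Orthogonality makes the convex function \<open>t \<mapsto> \<parallel>Tx + tAx\<parallel>\<close> lose at
  most \<open>s\<^sup>2\<close> between \<open>0\<close> and \<open>s\<close>, hence at most \<open>st\<close> up to any \<open>t \<ge> s\<close>. If (a) fails, then
  \<open>\<parallel>Ax\<parallel>\<close> is bounded below, so only \<open>t\<close> in a fixed bounded interval matter, and letting \<open>s \<rightarrow> 0\<close>
  gives the sequence \<open>x\<^sub>n\<close> of (b). Replacing \<open>A\<close> by \<open>-A\<close> gives \<open>y\<^sub>n\<close>.\<close>

text \<open>Otherwise \<open>max r 0\<close> would bound \<open>T\<close> on all vectors, and hence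
  \<open>norm T\<close>. The maximum keeps the bound nonnegative; when \<open>r < 0\<close> the
  contradiction comes from \<open>T \<noteq> 0\<close>. Rescaling then gives a unit vector.\<close>

lemma blinfun_norm_approx:
  fixes T :: "'a::real_normed_vector \<Rightarrow>\<^sub>L 'b::real_normed_vector"
  assumes "T \<noteq> 0" "r < norm T"
  obtains x where "norm x = 1" "r < norm (blinfun_apply T x)"
proof -
  have "\<not> (\<forall>x. norm (blinfun_apply T x) \<le> max r 0 * norm x)"
  proof
    assume "\<forall>x. norm (blinfun_apply T x) \<le> max r 0 * norm x"
    then have "norm T \<le> max r 0"
      by (intro norm_blinfun_bound) auto
    with assms show False
      by (simp add: max_def split: if_splits)
  qed
  then obtain x where x: "max r 0 * norm x < norm (blinfun_apply T x)"
    by (auto simp: not_le)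
  then have "x \<noteq> 0"
    by auto
  with x have "max r 0 < norm (blinfun_apply T x) / norm x"
    by (simp add: pos_less_divide_eq del: max_less_iff_conj)
  with \<open>x \<noteq> 0\<close> show ?thesis
    by (intro that[of "x /\<^sub>R norm x"]) (auto simp: blinfun.scaleR_right divide_inverse_commute)
qed

text \<open>Convexity of the norm along the ray: \<open>u + sv\<close> is the convex combination of
  \<open>u\<close> and \<open>u + tv\<close> with weights \<open>(t - s)/t\<close> and
  \<open>s/t\<close>. Multiplying through by \<open>t\<close> avoids the divisions.\<close>

lemma norm_ray_linear_lower_bound:
  fixes u v :: "'a::real_normed_vector"
  assumes "0 < s" "s \<le> t" "norm u - s * d \<le> norm (u + s *\<^sub>R v)"
  shows "norm u - t * d \<le> norm (u + t *\<^sub>R v)"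
proof -
  have "t * norm (u + s *\<^sub>R v) = norm ((t - s) *\<^sub>R u + s *\<^sub>R (u + t *\<^sub>R v))"
  proof -
    have "(t - s) *\<^sub>R u + s *\<^sub>R (u + t *\<^sub>R v) = t *\<^sub>R (u + s *\<^sub>R v)"
      by (simp add: algebra_simps)
    with assms show ?thesis
      by simp
  qed
  also have "\<dots> \<le> (t - s) * norm u + s * norm (u + t *\<^sub>R v)"
    using norm_triangle_ineq[of "(t - s) *\<^sub>R u" "s *\<^sub>R (u + t *\<^sub>R v)"] assms by simp
  finally have "t * (norm u - s * d) \<le> (t - s) * norm u + s * norm (u + t *\<^sub>R v)"
    using mult_left_mono[OF assms(3), of t] assms by linarith
  then have "s * (norm u - t * d) \<le> s * norm (u + t *\<^sub>R v)"
    by (simp add: algebra_simps)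
  with \<open>0 < s\<close> show ?thesis
    by simp
qed

text \<open>The substitution of \<open>-t\<close> for \<open>t\<close>. It turns the result for
  \<open>-A\<close> into the one for the negative half-line.\<close>

lemma uminus_mem_approx_plus_iff: "- v \<in> approx_plus \<epsilon> u \<longleftrightarrow> v \<in> approx_minus \<epsilon> u"
proof -
  have "(\<forall>t\<ge>0. P (- t)) \<longleftrightarrow> (\<forall>t\<le>0. P t)" for P :: "real \<Rightarrow> bool"
    by (metis minus_minus neg_0_le_iff_le)
  from this[of "\<lambda>t. sqrt (1 - \<epsilon>\<^sup>2) * norm u \<le> norm (u + t *\<^sub>R v)"] show ?thesis
    by (simp add: approx_plus_def approx_minus_def)
qed

text \<open>The ray is cut at \<open>s\<close> and \<open>M\<close>: up to \<open>s\<close> the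
  vector moves little, between them convexity controls the loss, and beyond \<open>M\<close> the
  term \<open>tAx\<close> dominates.\<close>

lemma exists_near_norming_approx_plus:
  fixes T A :: "'a::real_normed_vector \<Rightarrow>\<^sub>L 'b::real_normed_vector"
  assumes T: "T \<noteq> 0" and orth: "\<And>t. 0 \<le> t \<Longrightarrow> norm T \<le> norm (T + t *\<^sub>R A)"
    and "0 < c"
    and lower: "\<And>x. norm x = 1 \<Longrightarrow> norm T - c < norm (blinfun_apply T x) \<Longrightarrow> c \<le> norm (blinfun_apply A x)"
    and \<epsilon>: "0 < \<epsilon>" "\<epsilon> < 1"
  obtains x where "norm x = 1" "norm T - \<epsilon> < norm (blinfun_apply T x)"
    "blinfun_apply A x \<in> approx_plus \<epsilon> (blinfun_apply T x)"
proof -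
  define k where "k = sqrt (1 - \<epsilon>\<^sup>2)"
  \<comment> \<open>For \<open>t \<ge> M\<close> and \<open>norm v \<ge> c\<close> the norm of
    \<open>tv\<close> is at least \<open>2 * norm T\<close>, so that of \<open>u + tv\<close> is at
    least \<open>norm T\<close>.\<close>
  define M where "M = 2 * norm T / c"
  \<comment> \<open>The admissible loss. The entries in turn make \<open>x\<close> nearly norming,
    make \<open>lower\<close> applicable, keep \<open>norm u\<close> above
    \<open>norm T / 2\<close>, and thereby give \<open>d \<le> (1 - k) * norm u\<close>.\<close>
  define d where "d = Min {\<epsilon>, c, norm T / 2, (1 - k) * (norm T / 2)}"
  \<comment> \<open>Chosen so that \<open>s * s + s * norm A\<close> and \<open>s * M\<close> are
    both at most \<open>d\<close>; the cap \<open>1\<close> gives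
    \<open>s * s \<le> s\<close>.\<close>
  define s where "s = min 1 (d / (1 + norm A + M))"
  have nT: "0 < norm T"
    using T by simp
  have k: "k < 1"
    using \<epsilon> by (simp add: k_def power_le_one)
  have M: "0 < M"
    using nT \<open>0 < c\<close> by (simp add: M_def)
  have d: "0 < d" "d \<le> \<epsilon>" "d \<le> c" "d \<le> norm T / 2" "d \<le> (1 - k) * (norm T / 2)"
    using \<epsilon> \<open>0 < c\<close> nT k by (auto simp: d_def)
  have pos: "0 < 1 + norm A + M"
    using M norm_ge_zero[of A] by linarith
  have s: "0 < s" "s \<le> 1"
    using d(1) pos by (auto simp: s_def)
  have "s \<le> d / (1 + norm A + M)"
    by (simp add: s_def)
  then have sd: "s * (1 + norm A + M) \<le> d"
    using pos by (simp add: pos_le_divide_eq)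
  have ss: "s * s \<le> s"
    using s by (simp add: mult_left_le)
  have "0 \<le> s * norm A" "0 \<le> s * M"
    using s M by auto
  then have sA: "s * s + s * norm A \<le> d" and sM: "s * M \<le> d"
    using sd ss s(1) unfolding distrib_left mult_1_right by linarith+
  have TA: "norm T \<le> norm (T + s *\<^sub>R A)"
    using orth s by simp
  have "T + s *\<^sub>R A \<noteq> 0"
    using TA nT by auto
  moreover have "norm T - s * s < norm (T + s *\<^sub>R A)"
    using TA s by (smt (verit) mult_pos_pos)
  ultimately obtain x where x: "norm x = 1"
    and Tx: "norm T - s * s < norm (blinfun_apply (T + s *\<^sub>R A) x)"
    by (rule blinfun_norm_approx)
  define u where "u = blinfun_apply T x"
  define v where "v = blinfun_apply A x"
  have fs: "norm T - s * s < norm (u + s *\<^sub>R v)"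
    using Tx by (simp add: u_def v_def plus_blinfun.rep_eq scaleR_blinfun.rep_eq)
  have u_le: "norm u \<le> norm T" and v_le: "norm v \<le> norm A"
    using norm_blinfun[of T x] norm_blinfun[of A x] x by (simp_all add: u_def v_def)
  \<comment> \<open>Going back from \<open>s\<close> to \<open>t\<close> costs at most
    \<open>s * norm A\<close>, on top of the defect \<open>s * s\<close>. The case
    \<open>t = 0\<close> shows that \<open>x\<close> nearly norms \<open>T\<close> itself, not only
    \<open>T + sA\<close>.\<close>
  have small: "norm T - d < norm (u + t *\<^sub>R v)" if "0 \<le> t" "t \<le> s" for t
  proof -
    have "u + s *\<^sub>R v = (u + t *\<^sub>R v) + (s - t) *\<^sub>R v"
      by (simp add: algebra_simps)
    then have "norm (u + s *\<^sub>R v) \<le> norm (u + t *\<^sub>R v) + (s - t) * norm v"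
      using norm_triangle_ineq[of "u + t *\<^sub>R v" "(s - t) *\<^sub>R v"] that by (simp add: add.assoc)
    also have "(s - t) * norm v \<le> s * norm A"
      using that v_le s by (intro mult_mono) auto
    finally show ?thesis
      using fs sA by linarith
  qed
  have u_gt: "norm T - d < norm u"
    using small[of 0] s by simp
  have v_ge: "c \<le> norm v"
    using lower[OF x] u_gt d by (simp add: u_def v_def)
  have "norm T / 2 \<le> norm u"
    using u_gt d by linarith
  then have "(1 - k) * (norm T / 2) \<le> (1 - k) * norm u"
    using k by (intro mult_left_mono) auto
  then have ku: "k * norm u \<le> norm u - d"
    using d(5) unfolding left_diff_distrib mult_1 by linarith
  have "k * norm u \<le> norm (u + t *\<^sub>R v)" if "0 \<le> t" for t
  proof -
    consider "t \<le> s" | "s \<le> t" "t \<le> M" | "M \<le> t"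
      by linarith
    then have "norm u - d \<le> norm (u + t *\<^sub>R v)"
    proof cases
      case 1
      then show ?thesis
        using small[OF that] u_le by linarith
    next
      case 2
      have "norm u - s * s \<le> norm (u + s *\<^sub>R v)"
        using fs u_le by linarith
      \<comment> \<open>The slope \<open>d\<close> of that lemma is instantiated with
        \<open>s\<close>: this is why the error at \<open>s\<close> was taken quadratic.\<close>
      from norm_ray_linear_lower_bound[OF s(1) 2(1) this]
      have "norm u - t * s \<le> norm (u + t *\<^sub>R v)" .
      moreover have "t * s \<le> s * M"
        using 2 s by simp
      ultimately show ?thesis
        using sM by linarith
    next
      case 3
      have "2 * norm T = M * c"
        using \<open>0 < c\<close> by (simp add: M_def)
      also have "\<dots> \<le> t * norm v"
        using 3 M \<open>0 < c\<close> v_ge by (intro mult_mono) auto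
      also have "\<dots> \<le> norm (u + t *\<^sub>R v) + norm u"
        using norm_triangle_ineq4[of "u + t *\<^sub>R v" u] that by simp
      finally show ?thesis
        using u_le d by linarith
    qed
    with ku show ?thesis
      by linarith
  qed
  then have "v \<in> approx_plus \<epsilon> u"
    by (simp add: approx_plus_def k_def)
  with x u_gt d show ?thesis
    by (intro that[of x]) (auto simp: u_def v_def)
qed

lemma exists_norming_seq_approx_plus:
  fixes T A :: "'a::real_normed_vector \<Rightarrow>\<^sub>L 'b::real_normed_vector"
  assumes T: "T \<noteq> 0" and orth: "\<And>t. 0 \<le> t \<Longrightarrow> norm T \<le> norm (T + t *\<^sub>R A)"
    and c: "0 < c"
    "\<And>x. norm x = 1 \<Longrightarrow> norm T - c < norm (blinfun_apply T x) \<Longrightarrow> c \<le> norm (blinfun_apply A x)"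
    and \<epsilon>: "\<And>n::nat. 0 < \<epsilon> n" "\<And>n. \<epsilon> n < 1" "\<epsilon> \<longlonglongrightarrow> 0"
  obtains x where "\<And>n. norm (x n) = 1" "(\<lambda>n. norm (blinfun_apply T (x n))) \<longlonglongrightarrow> norm T"
    "\<And>n. blinfun_apply A (x n) \<in> approx_plus (\<epsilon> n) (blinfun_apply T (x n))"
proof -
  have "\<forall>n. \<exists>x. norm x = 1 \<and> norm T - \<epsilon> n < norm (blinfun_apply T x) \<and>
      blinfun_apply A x \<in> approx_plus (\<epsilon> n) (blinfun_apply T x)"
    using exists_near_norming_approx_plus[OF T orth c \<epsilon>(1,2)] by metis
  then obtain x where x: "\<And>n. norm (x n) = 1"
    "\<And>n. norm T - \<epsilon> n < norm (blinfun_apply T (x n))"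
    "\<And>n. blinfun_apply A (x n) \<in> approx_plus (\<epsilon> n) (blinfun_apply T (x n))"
    by metis
  have "(\<lambda>n. norm (blinfun_apply T (x n))) \<longlonglongrightarrow> norm T"
  proof (rule tendsto_sandwich)
    show "\<forall>\<^sub>F n in sequentially. norm T - \<epsilon> n \<le> norm (blinfun_apply T (x n))"
      using x(2) by (simp add: less_imp_le)
    show "\<forall>\<^sub>F n in sequentially. norm (blinfun_apply T (x n)) \<le> norm T"
      using norm_blinfun[of T] x(1) by (metis (no_types, lifting) always_eventually mult.right_neutral)
    show "(\<lambda>n. norm T - \<epsilon> n) \<longlonglongrightarrow> norm T"
      using tendsto_diff[OF tendsto_const \<epsilon>(3)] by simp
  qed simp
  with x show ?thesis
    by (intro that[of x])
qed

text \<open>If every \<open>c = 1/(n+1)\<close> failed, the counterexamples would form the excluded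
  sequence. One \<open>c\<close> can serve as both tolerances because both shrink together.\<close>

lemma no_norming_vanishing_seqD:
  fixes T A :: "'a::real_normed_vector \<Rightarrow>\<^sub>L 'b::real_normed_vector"
  assumes "\<nexists>x :: nat \<Rightarrow> 'a. (\<forall>n. norm (x n) = 1) \<and>
      (\<lambda>n. norm (blinfun_apply T (x n))) \<longlonglongrightarrow> norm T \<and> (\<lambda>n. norm (blinfun_apply A (x n))) \<longlonglongrightarrow> 0"
  obtains c where "0 < c"
    "\<And>x. norm x = 1 \<Longrightarrow> norm T - c < norm (blinfun_apply T x) \<Longrightarrow> c \<le> norm (blinfun_apply A x)"
proof (rule ccontr)
  let ?e = "\<lambda>n. inverse (real (Suc n))"
  assume "\<not> thesis"
  have "\<exists>x. norm x = 1 \<and> norm T - ?e n < norm (blinfun_apply T x) \<and> norm (blinfun_apply A x) < ?e n" for n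
    using that[of "?e n"] \<open>\<not> thesis\<close> by fastforce
  then obtain x where x: "\<And>n. norm (x n) = 1"
    "\<And>n. norm T - ?e n < norm (blinfun_apply T (x n))" "\<And>n. norm (blinfun_apply A (x n)) < ?e n"
    by metis
  have "(\<lambda>n. norm (blinfun_apply T (x n))) \<longlonglongrightarrow> norm T"
  proof (rule tendsto_sandwich)
    show "\<forall>\<^sub>F n in sequentially. norm T - ?e n \<le> norm (blinfun_apply T (x n))"
      using x(2) by (simp add: less_imp_le)
    show "\<forall>\<^sub>F n in sequentially. norm (blinfun_apply T (x n)) \<le> norm T"
      using norm_blinfun[of T] x(1) by (metis (no_types, lifting) always_eventually mult.right_neutral)
    show "(\<lambda>n. norm T - ?e n) \<longlonglongrightarrow> norm T"
      using tendsto_diff[OF tendsto_const LIMSEQ_inverse_real_of_nat] by simp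
  qed simp
  moreover have "(\<lambda>n. norm (blinfun_apply A (x n))) \<longlonglongrightarrow> 0"
    using x(3) by (intro tendsto_sandwich[OF _ _ tendsto_const LIMSEQ_inverse_real_of_nat])
      (auto simp: less_imp_le)
  ultimately show False
    using assms x(1) by blast
qed

text \<open>Evaluating \<open>T + tA\<close> at unit vectors bounds its norm from below, and the
  bound passes to the limit. Both conditions (a) and (b) enter through a suitable
  \<open>f\<close>.\<close>

lemma norm_le_norm_blinfun_add_if_seq:
  fixes T A :: "'a::real_normed_vector \<Rightarrow>\<^sub>L 'b::real_normed_vector"
  assumes "\<And>n. norm (x n) = 1" and "f \<longlonglongrightarrow> norm T"
    and "\<And>n::nat. f n \<le> norm (blinfun_apply T (x n) + t *\<^sub>R blinfun_apply A (x n))"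
  shows "norm T \<le> norm (T + t *\<^sub>R A)"
proof (rule LIMSEQ_le_const2[OF assms(2)], intro exI allI impI)
  fix n
  have "norm (blinfun_apply T (x n) + t *\<^sub>R blinfun_apply A (x n)) \<le> norm (T + t *\<^sub>R A)"
    using norm_blinfun[of "T + t *\<^sub>R A" "x n"] assms(1)[of n]
    by (simp add: plus_blinfun.rep_eq scaleR_blinfun.rep_eq)
  with assms(3)[of n] show "f n \<le> norm (T + t *\<^sub>R A)"
    by linarith
qed

lemma tendsto_sqrt_one_minus_square_mult:
  assumes "\<epsilon> \<longlonglongrightarrow> (0::real)" "f \<longlonglongrightarrow> l"
  shows "(\<lambda>n. sqrt (1 - (\<epsilon> n)\<^sup>2) * f n) \<longlonglongrightarrow> l"
proof -
  have "(\<lambda>n. sqrt (1 - (\<epsilon> n)\<^sup>2) * f n) \<longlonglongrightarrow> sqrt (1 - 0\<^sup>2) * l"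
    by (intro tendsto_intros assms)
  then show ?thesis
    by simp
qed

theorem theorem2p4:
  fixes T A :: "'a::real_normed_vector \<Rightarrow>\<^sub>L 'b::real_normed_vector"
  assumes "T \<noteq> 0"
  shows "T \<bottom>\<^sub>B A \<longleftrightarrow>
    (\<exists>x :: nat \<Rightarrow> 'a.
       (\<forall>n. x n \<in> sphere 0 1) \<and>
       (\<lambda>n. norm (blinfun_apply T (x n))) \<longlonglongrightarrow> norm T \<and>
       (\<lambda>n. norm (blinfun_apply A (x n))) \<longlonglongrightarrow> 0)
    \<or>
    (\<exists>(x :: nat \<Rightarrow> 'a) (y :: nat \<Rightarrow> 'a) (\<epsilon> :: nat \<Rightarrow> real) (\<delta> :: nat \<Rightarrow> real).
       (\<forall>n. x n \<in> sphere 0 1 \<and> y n \<in> sphere 0 1) \<and>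
       (\<forall>n. 0 < \<epsilon> n \<and> \<epsilon> n < 1 \<and> 0 < \<delta> n \<and> \<delta> n < 1) \<and>
       \<epsilon> \<longlonglongrightarrow> 0 \<and> \<delta> \<longlonglongrightarrow> 0 \<and>
       (\<lambda>n. norm (blinfun_apply T (x n))) \<longlonglongrightarrow> norm T \<and>
       (\<lambda>n. norm (blinfun_apply T (y n))) \<longlonglongrightarrow> norm T \<and>
       (\<forall>n. blinfun_apply A (x n) \<in> approx_plus (\<epsilon> n) (blinfun_apply T (x n)) \<and>
            blinfun_apply A (y n) \<in> approx_minus (\<delta> n) (blinfun_apply T (y n))))"
    (is "_ \<longleftrightarrow> ?a \<or> ?b")
proof
  assume "T \<bottom>\<^sub>B A"
  then have orth: "norm T \<le> norm (T + t *\<^sub>R A)" for t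
    by (simp add: birkhoff_james_def)
  have ?b if "\<not> ?a"
  proof -
    from that obtain c where c: "0 < c"
      "\<And>x. norm x = 1 \<Longrightarrow> norm T - c < norm (blinfun_apply T x) \<Longrightarrow> c \<le> norm (blinfun_apply A x)"
      using no_norming_vanishing_seqD[of T A] by (auto simp only: mem_sphere_0)
    \<comment> \<open>The shift by two makes \<open>\<epsilon> 0\<close> equal to
      \<open>1/2\<close>; with a single \<open>Suc\<close> it would be \<open>1\<close>, violating
      the strict bound.\<close>
    define \<epsilon> where "\<epsilon> n = inverse (real (Suc (Suc n)))" for n
    have \<epsilon>: "0 < \<epsilon> n" "\<epsilon> n < 1" for n
      by (simp_all add: \<epsilon>_def field_simps)
    have \<epsilon>_lim: "\<epsilon> \<longlonglongrightarrow> 0"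
      unfolding \<epsilon>_def by (rule LIMSEQ_Suc[OF LIMSEQ_inverse_real_of_nat])
    obtain x where x: "\<And>n. norm (x n) = 1" "(\<lambda>n. norm (blinfun_apply T (x n))) \<longlonglongrightarrow> norm T"
      "\<And>n. blinfun_apply A (x n) \<in> approx_plus (\<epsilon> n) (blinfun_apply T (x n))"
      using exists_norming_seq_approx_plus[OF assms orth c \<epsilon> \<epsilon>_lim] by blast
    \<comment> \<open>All hypotheses are invariant under replacing \<open>A\<close> by
      \<open>-A\<close>, and the same \<open>\<epsilon>\<close> then serves as
      \<open>\<delta>\<close>.\<close>
    have orth': "norm T \<le> norm (T + t *\<^sub>R (- A))" for t
      using orth[of "- t"] by simp
    have c': "c \<le> norm (blinfun_apply (- A) x)"
      if "norm x = 1" "norm T - c < norm (blinfun_apply T x)" for x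
      using c(2)[OF that] by (simp add: uminus_blinfun.rep_eq)
    obtain y where y: "\<And>n. norm (y n) = 1" "(\<lambda>n. norm (blinfun_apply T (y n))) \<longlonglongrightarrow> norm T"
      "\<And>n. blinfun_apply (- A) (y n) \<in> approx_plus (\<epsilon> n) (blinfun_apply T (y n))"
      using exists_norming_seq_approx_plus[OF assms orth' c(1) c' \<epsilon> \<epsilon>_lim] by blast
    have "blinfun_apply A (y n) \<in> approx_minus (\<epsilon> n) (blinfun_apply T (y n))" for n
      using y(3)[of n] by (simp add: uminus_blinfun.rep_eq uminus_mem_approx_plus_iff)
    with x y(1,2) \<epsilon> \<epsilon>_lim show ?b
      by (intro exI[of _ x] exI[of _ y] exI[of _ \<epsilon>]) auto
  qed
  then show "?a \<or> ?b"
    by blast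
next
  assume "?a \<or> ?b"
  then show "T \<bottom>\<^sub>B A"
  proof
    assume ?a
    then obtain x where x: "\<And>n. norm (x n) = 1"
      "(\<lambda>n. norm (blinfun_apply T (x n))) \<longlonglongrightarrow> norm T" "(\<lambda>n. norm (blinfun_apply A (x n))) \<longlonglongrightarrow> 0"
      by auto
    have "norm T \<le> norm (T + t *\<^sub>R A)" for t
    \<comment> \<open>Here \<open>f\<close> is the lower bound from the reverse triangle
      inequality.\<close>
    proof (rule norm_le_norm_blinfun_add_if_seq[OF x(1)])
      show "(\<lambda>n. norm (blinfun_apply T (x n)) - \<bar>t\<bar> * norm (blinfun_apply A (x n))) \<longlonglongrightarrow> norm T"
        using tendsto_diff[OF x(2) tendsto_mult_left[OF x(3), of "\<bar>t\<bar>"]] by simp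
      show "norm (blinfun_apply T (x n)) - \<bar>t\<bar> * norm (blinfun_apply A (x n))
          \<le> norm (blinfun_apply T (x n) + t *\<^sub>R blinfun_apply A (x n))" for n
        using norm_diff_ineq[of "blinfun_apply T (x n)" "t *\<^sub>R blinfun_apply A (x n)"] by simp
    qed
    then show ?thesis
      by (simp add: birkhoff_james_def)
  next
    assume ?b
    then obtain x y \<epsilon> \<delta> where x: "\<And>n. norm (x n) = 1" and y: "\<And>n. norm (y n) = 1"
      and lim: "\<epsilon> \<longlonglongrightarrow> 0" "\<delta> \<longlonglongrightarrow> 0" "(\<lambda>n. norm (blinfun_apply T (x n))) \<longlonglongrightarrow> norm T"
        "(\<lambda>n. norm (blinfun_apply T (y n))) \<longlonglongrightarrow> norm T"
      and mem: "\<And>n. blinfun_apply A (x n) \<in> approx_plus (\<epsilon> n) (blinfun_apply T (x n))"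
        "\<And>n. blinfun_apply A (y n) \<in> approx_minus (\<delta> n) (blinfun_apply T (y n))"
      by (simp only: mem_sphere_0) blast
    have "norm T \<le> norm (T + t *\<^sub>R A)" for t
    \<comment> \<open>The sign of \<open>t\<close> decides which sequence is used: \<open>x\<close>
      for \<open>t \<ge> 0\<close>, \<open>y\<close> for \<open>t < 0\<close>.\<close>
    proof (cases "0 \<le> t")
      case True
      show ?thesis
        by (rule norm_le_norm_blinfun_add_if_seq[where x = x, OF x
              tendsto_sqrt_one_minus_square_mult[OF lim(1,3)]])
          (use mem(1) True in \<open>auto simp: approx_plus_def\<close>)
    next
      case False
      show ?thesis
        by (rule norm_le_norm_blinfun_add_if_seq[where x = y, OF y
              tendsto_sqrt_one_minus_square_mult[OF lim(2,4)]])
          (use mem(2) False in \<open>auto simp: approx_minus_def\<close>)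
    qed
    then show ?thesis
      by (simp add: birkhoff_james_def)
  qed
qed

end
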